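(* Let $G=(V,E,w)$ be a weighted hypergraph on $N$ vertices, all of positive degree, with maximum edge cardinality $\nabla$. Then each of the tensors $A$, $K$, $K^+$, $L$, $L^+$, $\mathcal{L}$, $\mathcal{L}^+$ of $G$ is weakly irreducible if and only if $G$ is connected.
   Context: A $k$-th order $n$-dimensional tensor $T$ is weakly irreducible if for every non-empty proper subset $J\subsetneq[n]$ there is a nonzero entry $T_{i_1,\ldots,i_k}$ with $i_1\in J$ and at least one of $i_2,\dots,i_k$ in $[n]\setminus J$. Hypergraphs: $G=(V,E,w)$, $V=\{v_1,\dots,v_N\}$, edges are subsets of $V$ of size $\ge2$, $w:E\to\mathbb{R}_{>0}$, $\deg v=\sum_{e\ni v}w(e)$, $\nabla=\max|e|$, $E_r=\{e:|e|=r\}$, $N(r,k)=(r-1)!\cdot\frac{1}{r!}\sum_{j=0}^r(-1)^j\binom{r}{j}(r-j)^k$. $G$ is connected if for any two vertices $v,w$ there are vertices $v=\hat v_1,\dots,\hat v_k=w$ and edges $\hat e_1,\dots,\hat e_{k-1}$ with $\{\hat v_i,\hat v_{i+1}\}\subseteq\hat e_i$. All tensors are $\nabla$-th order $N$-dimensional. $A_{i_1,\ldots,i_\nabla}=w(e)/N(r,\nabla)$ if $\{v_{i_1},\ldots,v_{i_\nabla}\}=e\in E_r$, else $0$. $K$ / $K^+$: diagonal $\deg v_i$, off-diagonal $\mp A_{i_1,\ldots,i_\nabla}$. $L$ / $L^+$: diagonal $1$, off-diagonal $\mp A_{i_1,\ldots,i_\nabla}\prod_{j\in\{i_1,\ldots,i_\nabla\}}(\deg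 v_j)^{-1/\nabla}$ (product over distinct indices). $\mathcal L$ / $\mathcal L^+$: diagonal $1$, off-diagonal $\mp A_{i_1,\ldots,i_\nabla}/\deg v_{i_1}$ (minus sign for the unsigned-less tensors $K,L,\mathcal L$, plus for $K^+,L^+,\mathcal L^+$). *)

theory Defs
  imports Complex_Main
begin

text \<open>
  A \<open>k\<close>-th order \<open>n\<close>-dimensional real tensor is a function on index lists
  \<open>[i\<^sub>1, \<dots>, i\<^sub>k]\<close> with entries in \<open>{1..n}\<close>. List positions count from 0, so \<open>i\<^sub>1\<close> is
  \<open>ix ! 0\<close>. Values on other lists are irrelevant: every use of a tensor below is restricted
  to \<open>tensor_indices k n\<close>.
\<close>

type_synonym tensor = "nat list \<Rightarrow> real"

definition tensor_indices :: "nat \<Rightarrow> nat \<Rightarrow> nat list set" where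
  "tensor_indices k n = {ix. length ix = k \<and> set ix \<subseteq> {1..n}}"

definition weakly_irreducible :: "nat \<Rightarrow> nat \<Rightarrow> tensor \<Rightarrow> bool" where
  "weakly_irreducible k n T \<longleftrightarrow>
     (\<forall>J. J \<noteq> {} \<and> J \<subset> {1..n} \<longrightarrow>
        (\<exists>ix \<in> tensor_indices k n. T ix \<noteq> 0 \<and> ix ! 0 \<in> J \<and>
           (\<exists>m \<in> {1..<k}. ix ! m \<in> {1..n} - J)))"

definition diagonal_index :: "nat list \<Rightarrow> bool" where
  "diagonal_index ix \<longleftrightarrow> (\<forall>i \<in> set ix. \<forall>j \<in> set ix. i = j)"

locale weighted_hypergraph =
  fixes V :: "'a set" and E :: "'a set set" and w :: "'a set \<Rightarrow> real"
  assumes finite_V: "finite V"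
    and edge_subset: "e \<in> E \<Longrightarrow> e \<subseteq> V"
    and edge_card: "e \<in> E \<Longrightarrow> card e \<ge> 2"
    and weight_pos: "e \<in> E \<Longrightarrow> w e > 0"

definition deg :: "'a set set \<Rightarrow> ('a set \<Rightarrow> real) \<Rightarrow> 'a \<Rightarrow> real" where
  "deg E w x = (\<Sum>e \<in> {e \<in> E. x \<in> e}. w e)"

definition max_edge_card :: "'a set set \<Rightarrow> nat" where
  "max_edge_card E = Max (card ` E)"

definition hypergraph_connected :: "'a set \<Rightarrow> 'a set set \<Rightarrow> bool" where
  "hypergraph_connected V E \<longleftrightarrow>
     (\<forall>x \<in> V. \<forall>y \<in> V. \<exists>vs es. vs \<noteq> [] \<and> set vs \<subseteq> V \<and> set es \<subseteq> E \<and>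
        length vs = Suc (length es) \<and> hd vs = x \<and> last vs = y \<and>
        (\<forall>i < length es. {vs ! i, vs ! Suc i} \<subseteq> es ! i))"

text \<open>
  \<open>N(r,k) = (r-1)! S(k,r)\<close> with \<open>S(k,r)\<close> the Stirling number of the second kind in its explicit
  form. Equivalently, \<open>r N(r,k)\<close> is the number of \<open>k\<close>-tuples whose set of entries is a given
  \<open>r\<close>-element set.
\<close>

definition normalization_const :: "nat \<Rightarrow> nat \<Rightarrow> real" where
  "normalization_const r k =
     fact (r - 1) * (1 / fact r *
       (\<Sum>j = 0..r. (-1) ^ j * real (r choose j) * (real r - real j) ^ k))"

text \<open>
  In the tensors below, \<open>v\<close> enumerates the vertices as \<open>v 1, \<dots>, v N\<close>, and
  \<open>v ` set ix\<close> is the set of vertices whose indices occur in \<open>ix\<close>.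
\<close>

definition tensor_A :: "'a set set \<Rightarrow> ('a set \<Rightarrow> real) \<Rightarrow> (nat \<Rightarrow> 'a) \<Rightarrow> tensor" where
  "tensor_A E w v ix =
     (let e = v ` set ix in
        if e \<in> E then w e / normalization_const (card e) (max_edge_card E) else 0)"

definition tensor_K :: "'a set set \<Rightarrow> ('a set \<Rightarrow> real) \<Rightarrow> (nat \<Rightarrow> 'a) \<Rightarrow> tensor" where
  "tensor_K E w v ix =
     (if diagonal_index ix then deg E w (v (ix ! 0)) else - tensor_A E w v ix)"

definition tensor_K_plus :: "'a set set \<Rightarrow> ('a set \<Rightarrow> real) \<Rightarrow> (nat \<Rightarrow> 'a) \<Rightarrow> tensor" where
  "tensor_K_plus E w v ix =
     (if diagonal_index ix then deg E w (v (ix ! 0)) else tensor_A E w v ix)"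

text \<open>The products run over \<open>set ix\<close>, so each distinct index contributes once.\<close>

definition tensor_L :: "'a set set \<Rightarrow> ('a set \<Rightarrow> real) \<Rightarrow> (nat \<Rightarrow> 'a) \<Rightarrow> tensor" where
  "tensor_L E w v ix =
     (if diagonal_index ix then 1
      else - (tensor_A E w v ix *
              (\<Prod>j \<in> set ix. deg E w (v j) powr (- 1 / real (max_edge_card E)))))"

definition tensor_L_plus :: "'a set set \<Rightarrow> ('a set \<Rightarrow> real) \<Rightarrow> (nat \<Rightarrow> 'a) \<Rightarrow> tensor" where
  "tensor_L_plus E w v ix =
     (if diagonal_index ix then 1
      else tensor_A E w v ix *
           (\<Prod>j \<in> set ix. deg E w (v j) powr (- 1 / real (max_edge_card E))))"

definition tensor_calL :: "'a set set \<Rightarrow> ('a set \<Rightarrow> real) \<Rightarrow> (nat \<Rightarrow> 'a) \<Rightarrow> tensor" where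
  "tensor_calL E w v ix =
     (if diagonal_index ix then 1 else - (tensor_A E w v ix / deg E w (v (ix ! 0))))"

definition tensor_calL_plus :: "'a set set \<Rightarrow> ('a set \<Rightarrow> real) \<Rightarrow> (nat \<Rightarrow> 'a) \<Rightarrow> tensor" where
  "tensor_calL_plus E w v ix =
     (if diagonal_index ix then 1 else tensor_A E w v ix / deg E w (v (ix ! 0)))"

end

theory Submission
  imports Defs "HOL-Combinatorics.Stirling"
begin

text \<open>
  For a non-diagonal index list, an entry of any of the seven tensors is non-zero iff the indexed
  vertices form an edge; the normalising constants do not vanish because they are positive
  multiples of Stirling numbers. Diagonal entries never witness weak irreducibility, so all seven
  tensors say the same thing: every non-trivial vertex cut is crossed by an edge. The index list
  of a crossing edge exists because an edge has at most as many elements as the tensor has slots.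
\<close>

text \<open>By inclusion-exclusion, \<open>F s k\<close> counts the surjections from a
  \<open>k\<close>-set onto an \<open>s\<close>-set. In the recurrence, the last point has
  \<open>Suc s\<close> possible images, and the other \<open>k\<close> points cover either all
  \<open>Suc s\<close> values or exactly the remaining \<open>s\<close>. The proof is purely
  algebraic.\<close>

lemma sum_surjections_Suc:
  fixes s k :: nat
  defines "F \<equiv> \<lambda>s k. \<Sum>j\<le>s. (-1) ^ j * real (s choose j) * (real s - real j) ^ k"
  shows "F (Suc s) (Suc k) = real (Suc s) * (F (Suc s) k + F s k)"
proof -
  let ?g = "\<lambda>j. (real (Suc s) - real j) ^ k"
  have shift: "(\<Sum>j\<le>Suc s. (-1) ^ j * real (s choose j) * ?g j) = F (Suc s) k + F s k"
  proof -
    \<comment> \<open>Pascal's rule splits the coefficients. Since \<open>Suc s - Suc j\<close>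
      equals \<open>s - j\<close>, the part with \<open>s choose j\<close> sums to
      \<open>- F s k\<close>.\<close>
    have "F (Suc s) k = ?g 0 +
        (\<Sum>j\<le>s. (-1) ^ Suc j * (real (s choose j) + real (s choose Suc j)) * ?g (Suc j))"
      unfolding F_def by (subst sum.atMost_Suc_shift) simp
    also have "\<dots> = (?g 0 + (\<Sum>j\<le>s. (-1) ^ Suc j * real (s choose Suc j) * ?g (Suc j))) - F s k"
      unfolding F_def by (simp add: algebra_simps sum.distrib sum_negf sum_subtractf)
    also have "?g 0 + (\<Sum>j\<le>s. (-1) ^ Suc j * real (s choose Suc j) * ?g (Suc j))
        = (\<Sum>j\<le>Suc s. (-1) ^ j * real (s choose j) * ?g j)"
      by (subst sum.atMost_Suc_shift) simp
    finally show ?thesis by simp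
  qed
  \<comment> \<open>One factor of the power lowers the upper index of the binomial coefficient; at
    \<open>j = Suc s\<close> both sides vanish.\<close>
  have absorb: "real (Suc s choose j) * (real (Suc s) - real j) = real (Suc s) * real (s choose j)"
    if "j \<le> Suc s" for j
  proof -
    have "real ((Suc s - j) * (Suc s choose j)) = real (Suc s * (s choose j))"
      using binomial_absorb_comp[of "Suc s" j] by (metis diff_Suc_1)
    then show ?thesis
      using that by (simp only: of_nat_mult of_nat_diff mult.commute)
  qed
  have "F (Suc s) (Suc k)
      = (\<Sum>j\<le>Suc s. (-1) ^ j * (real (Suc s choose j) * (real (Suc s) - real j)) * ?g j)"
    unfolding F_def by (intro sum.cong refl) (simp only: power_Suc mult_ac)
  also have "\<dots> = (\<Sum>j\<le>Suc s. real (Suc s) * ((-1) ^ j * real (s choose j) * ?g j))"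
    by (intro sum.cong refl) (simp only: absorb atMost_iff mult_ac)
  also have "\<dots> = real (Suc s) * (F (Suc s) k + F s k)"
    by (simp only: sum_distrib_left[symmetric] shift)
  finally show ?thesis .
qed

text \<open>The Stirling recurrence multiplied by \<open>fact (Suc t)\<close> is the recurrence of
  the sums. For \<open>k = 0\<close> the sum is the alternating sum of binomial coefficients, zero
  unless \<open>s = 0\<close>.\<close>

lemma sum_surjections_eq_Stirling:
  "(\<Sum>j\<le>s. (-1) ^ j * real (s choose j) * (real s - real j) ^ k) = fact s * real (Stirling k s)"
proof (induction k arbitrary: s)
  case 0
  show ?case
    using choose_alternating_sum[of s, where 'a = real] by (cases s) auto
next
  case (Suc k)
  show ?case
  proof (cases s)
    case 0
    then show ?thesis by simp
  next
    case (Suc t)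
    show ?thesis
      unfolding Suc sum_surjections_Suc Suc.IH by (simp add: algebra_simps)
  qed
qed

text \<open>The summand \<open>Suc t * Stirling k (Suc t)\<close> of the recurrence is positive by
  induction, except on the diagonal \<open>s = Suc k\<close>, where the Stirling number is
  1.\<close>

lemma Stirling_pos: "1 \<le> s \<Longrightarrow> s \<le> k \<Longrightarrow> 0 < Stirling k s"
proof (induction k arbitrary: s)
  case 0
  then show ?case by simp
next
  case (Suc k)
  then obtain t where "s = Suc t" by (cases s) auto
  with Suc show ?case
    by (cases "s = Suc k") (auto simp: Stirling_same)
qed

lemma normalization_const_pos:
  assumes "1 \<le> s" "s \<le> k"
  shows "0 < normalization_const s k"
  unfolding normalization_const_def atLeast0AtMost sum_surjections_eq_Stirling
  using Stirling_pos[OF assms] by simp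

definition adjacency :: "'a set set \<Rightarrow> 'a rel" where
  "adjacency E = {(x, y). \<exists>e \<in> E. x \<in> e \<and> y \<in> e}"

text \<open>With a closure in place of explicit walks, the cut arguments can extend reachability by
  one edge and use induction along a path.\<close>

lemma (in weighted_hypergraph) hypergraph_connected_iff_adjacency:
  "hypergraph_connected V E \<longleftrightarrow> (\<forall>x \<in> V. \<forall>y \<in> V. (x, y) \<in> (adjacency E)\<^sup>*)"
proof (intro iffI ballI)
  fix x y assume "hypergraph_connected V E" "x \<in> V" "y \<in> V"
  then obtain vs es where path: "vs \<noteq> []" "set es \<subseteq> E" "length vs = Suc (length es)"
      "hd vs = x" "last vs = y" "\<forall>i < length es. {vs ! i, vs ! Suc i} \<subseteq> es ! i"
    unfolding hypergraph_connected_def by meson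
  have "(x, vs ! i) \<in> (adjacency E)\<^sup>*" if "i \<le> length es" for i
    using that
  proof (induction i)
    case 0
    then show ?case using path by (simp add: hd_conv_nth)
  next
    case (Suc i)
    then have "es ! i \<in> E" "{vs ! i, vs ! Suc i} \<subseteq> es ! i"
      using path by (auto simp: Suc_le_eq)
    then have "(vs ! i, vs ! Suc i) \<in> adjacency E"
      unfolding adjacency_def by blast
    with Suc show ?case by (meson Suc_leD rtrancl.rtrancl_into_rtrancl)
  qed
  from this[of "length es"] show "(x, y) \<in> (adjacency E)\<^sup>*"
    using path by (simp add: last_conv_nth)
next
  assume reach: "\<forall>x \<in> V. \<forall>y \<in> V. (x, y) \<in> (adjacency E)\<^sup>*"
  have path: "\<exists>vs es. vs \<noteq> [] \<and> set vs \<subseteq> V \<and> set es \<subseteq> E \<and>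
      length vs = Suc (length es) \<and> hd vs = x \<and> last vs = y \<and>
      (\<forall>i < length es. {vs ! i, vs ! Suc i} \<subseteq> es ! i)"
    if "x \<in> V" "(x, y) \<in> (adjacency E)\<^sup>*" for x y
    using that(2)
  proof (induction rule: rtrancl_induct)
    case base
    show ?case using that(1) by (intro exI[of _ "[x]"] exI[of _ "[]"]) auto
  next
    case (step y z)
    then obtain e where e: "e \<in> E" "y \<in> e" "z \<in> e"
      unfolding adjacency_def by blast
    obtain vs es where "vs \<noteq> []" "set vs \<subseteq> V" "set es \<subseteq> E"
        "length vs = Suc (length es)" "hd vs = x" "last vs = y"
        "\<forall>i < length es. {vs ! i, vs ! Suc i} \<subseteq> es ! i"
      using step.IH by blast
    then show ?case
      using e edge_subset[of e]
      by (intro exI[of _ "vs @ [z]"] exI[of _ "es @ [e]"])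
        (auto simp: nth_append less_Suc_eq last_conv_nth)
  qed
  then show "hypergraph_connected V E"
    using reach unfolding hypergraph_connected_def by blast
qed

lemma (in weighted_hypergraph) finite_E: "finite E"
  using finite_V edge_subset by (meson Pow_iff finite_Pow_iff finite_subset subsetI)

lemma (in weighted_hypergraph) card_le_max_edge_card: "e \<in> E \<Longrightarrow> card e \<le> max_edge_card E"
  unfolding max_edge_card_def using finite_E by simp

text \<open>The size of an edge lies between 2 and \<open>max_edge_card E\<close>, within the range
  where the normalising constant is positive.\<close>

lemma (in weighted_hypergraph) tensor_A_nonzero_iff:
  "tensor_A E w v ix \<noteq> 0 \<longleftrightarrow> v ` set ix \<in> E"
proof (cases "v ` set ix \<in> E")
  case True
  then have "normalization_const (card (v ` set ix)) (max_edge_card E) > 0"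
    using edge_card[OF True] card_le_max_edge_card[OF True] by (intro normalization_const_pos) auto
  then show ?thesis
    using True weight_pos[OF True] by (simp add: tensor_A_def)
qed (simp add: tensor_A_def)

lemma exists_list_of_length_starting_with:
  assumes "finite I" "i \<in> I" "card I \<le> k"
  shows "\<exists>ix. length ix = k \<and> set ix = I \<and> ix ! 0 = i"
proof -
  obtain xs where xs: "set xs = I - {i}" "distinct xs"
    using finite_distinct_list[of "I - {i}"] assms(1) by auto
  then have len: "Suc (length xs) = card I"
    using assms by (metis card_Suc_Diff1 distinct_card)
  \<comment> \<open>Spare slots are filled with copies of \<open>i\<close>, which leave the set of
    entries unchanged.\<close>
  let ?ix = "i # xs @ replicate (k - card I) i"
  have "length ?ix = k" using len assms(3) by simp
  moreover have "set ?ix = insert i (set xs)" by auto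
  then have "set ?ix = I" by (simp only: xs(1) insert_Diff[OF assms(2)])
  moreover have "?ix ! 0 = i" by simp
  ultimately show ?thesis by blast
qed

text \<open>An arbitrary \<open>T\<close> lets all seven tensors share one proof.
  \<open>support\<close> can ignore diagonal lists, because a witness has entries both inside and
  outside \<open>J\<close>.\<close>

lemma (in weighted_hypergraph) weakly_irreducible_iff_connected:
  assumes bij: "bij_betw v {1..N} V"
    and support: "\<And>ix. ix \<in> tensor_indices (max_edge_card E) N \<Longrightarrow> \<not> diagonal_index ix \<Longrightarrow>
      T ix \<noteq> 0 \<longleftrightarrow> v ` set ix \<in> E"
  shows "weakly_irreducible (max_edge_card E) N T \<longleftrightarrow> hypergraph_connected V E"
proof
  let ?r = "max_edge_card E"
  assume irr: "weakly_irreducible ?r N T"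
  have "(x, y) \<in> (adjacency E)\<^sup>*" if "x \<in> V" "y \<in> V" for x y
  proof (rule ccontr)
    assume unreachable: "(x, y) \<notin> (adjacency E)\<^sup>*"
    \<comment> \<open>The cut around everything reachable from \<open>x\<close>: an edge crossing it
      would make a further vertex reachable.\<close>
    define J where "J = {i \<in> {1..N}. (x, v i) \<in> (adjacency E)\<^sup>*}"
    have "x \<in> v ` {1..N}" "y \<in> v ` {1..N}"
      using that bij_betw_imp_surj_on[OF bij] by auto
    then obtain i j where "i \<in> {1..N}" "v i = x" "j \<in> {1..N}" "v j = y"
      by blast
    then have "i \<in> J" "j \<in> {1..N} - J"
      using unreachable unfolding J_def by auto
    moreover have "J \<subseteq> {1..N}"
      unfolding J_def by blast
    ultimately have "J \<noteq> {}" "J \<subset> {1..N}"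
      by blast+
    then obtain ix m where ix: "ix \<in> tensor_indices ?r N" "T ix \<noteq> 0" "ix ! 0 \<in> J"
        and m: "m \<in> {1..<?r}" "ix ! m \<in> {1..N} - J"
      using irr unfolding weakly_irreducible_def by meson
    have mem: "ix ! 0 \<in> set ix" "ix ! m \<in> set ix"
      using ix(1) m(1) unfolding tensor_indices_def by auto
    then have "\<not> diagonal_index ix"
      using ix(3) m(2) unfolding diagonal_index_def by fastforce
    then have "v ` set ix \<in> E"
      using support ix by blast
    then have "(v (ix ! 0), v (ix ! m)) \<in> adjacency E"
      using mem unfolding adjacency_def by blast
    then have "ix ! m \<in> J"
      using ix(3) m(2) unfolding J_def by (auto intro: rtrancl_into_rtrancl)
    then show False using m(2) by blast
  qed
  then show "hypergraph_connected V E"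
    unfolding hypergraph_connected_iff_adjacency by blast
next
  let ?r = "max_edge_card E"
  assume conn: "hypergraph_connected V E"
  show "weakly_irreducible ?r N T"
    unfolding weakly_irreducible_def
  proof (intro allI impI, elim conjE)
    fix J assume J: "J \<noteq> {}" "J \<subset> {1..N}"
    then obtain a b where a: "a \<in> J" and b: "b \<in> {1..N} - J" by blast
    have inj: "inj_on v {1..N}" and img: "v ` {1..N} = V"
      using bij unfolding bij_betw_def by auto
    have "(v a, v b) \<in> (adjacency E)\<^sup>*"
      using conn a b J img unfolding hypergraph_connected_iff_adjacency by blast
    moreover have "v a \<in> v ` J" using a by blast
    moreover have "v b \<notin> v ` J"
      using b J inj by (meson DiffD1 DiffD2 inj_on_image_mem_iff psubset_imp_subset)
    \<comment> \<open>A path that starts in \<open>v\<close>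
      J\<open>and ends outside it has a step that leaves\<close>v \<open>J\<close>.\<close>
    ultimately obtain x y where "(x, y) \<in> adjacency E" "x \<in> v ` J" "y \<notin> v ` J"
      by (induction rule: rtrancl_induct) blast+
    then obtain e where e: "e \<in> E" "x \<in> e" "y \<in> e" and x: "x \<in> v ` J" and y: "y \<notin> v ` J"
      unfolding adjacency_def by blast
    \<comment> \<open>Injectivity of \<open>v\<close> gives \<open>I\<close> the size of
      \<open>e\<close>, so its elements fit into \<open>?r\<close> slots.\<close>
    define I where "I = {i \<in> {1..N}. v i \<in> e}"
    have "v ` I = e"
      using e(1) edge_subset img unfolding I_def by blast
    moreover have "card (v ` I) = card I"
      by (rule card_image, rule inj_on_subset[OF inj]) (auto simp: I_def)
    ultimately have I: "v ` I = e" "card I \<le> ?r"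
      using card_le_max_edge_card[OF e(1)] by auto
    obtain i where "i \<in> J" "v i = x"
      using x by blast
    then have i: "i \<in> I" "i \<in> J"
      using e(2) J(2) unfolding I_def by auto
    obtain j where "j \<in> I" "v j = y"
      using e(3) I(1) by blast
    then have j: "j \<in> I" "j \<notin> J"
      using y by auto
    obtain ix where ix: "length ix = ?r" "set ix = I" "ix ! 0 = i"
      using exists_list_of_length_starting_with[of I i ?r] i(1) I(2) unfolding I_def by auto
    obtain m where m: "m < ?r" "ix ! m = j"
      using ix j(1) by (metis in_set_conv_nth)
    have "m \<noteq> 0" using m(2) ix(3) i(2) j(2) by metis
    have "I \<subseteq> {1..N}"
      unfolding I_def by blast
    then have mem: "ix \<in> tensor_indices ?r N"
      using ix(1,2) by (simp add: tensor_indices_def)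
    have "\<not> diagonal_index ix"
      using ix(2) i j unfolding diagonal_index_def by metis
    then have "T ix \<noteq> 0"
      using support[OF mem] ix(2) I(1) e(1) by simp
    moreover have "m \<in> {1..<?r}"
      using m(1) \<open>m \<noteq> 0\<close> by simp
    moreover have "ix ! m \<in> {1..N} - J"
      using m(2) j \<open>I \<subseteq> {1..N}\<close> by blast
    ultimately show "\<exists>ix \<in> tensor_indices ?r N. T ix \<noteq> 0 \<and> ix ! 0 \<in> J \<and>
        (\<exists>m \<in> {1..<?r}. ix ! m \<in> {1..N} - J)"
      using mem ix(3) i(2) by blast
  qed
qed

theorem theorem3p8:
  fixes V :: "'a set" and E :: "'a set set" and w :: "'a set \<Rightarrow> real"
    and v :: "nat \<Rightarrow> 'a" and N r :: nat
  assumes "weighted_hypergraph V E w"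
    and "bij_betw v {1..N} V"
    and "\<And>x. x \<in> V \<Longrightarrow> deg E w x > 0"
    and "r = max_edge_card E"
  shows "(weakly_irreducible r N (tensor_A E w v) \<longleftrightarrow> hypergraph_connected V E) \<and>
    (weakly_irreducible r N (tensor_K E w v) \<longleftrightarrow> hypergraph_connected V E) \<and>
    (weakly_irreducible r N (tensor_K_plus E w v) \<longleftrightarrow> hypergraph_connected V E) \<and>
    (weakly_irreducible r N (tensor_L E w v) \<longleftrightarrow> hypergraph_connected V E) \<and>
    (weakly_irreducible r N (tensor_L_plus E w v) \<longleftrightarrow> hypergraph_connected V E) \<and>
    (weakly_irreducible r N (tensor_calL E w v) \<longleftrightarrow> hypergraph_connected V E) \<and>
    (weakly_irreducible r N (tensor_calL_plus E w v) \<longleftrightarrow> hypergraph_connected V E)"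
proof -
  interpret weighted_hypergraph V E w by fact
  have deg_pos: "deg E w (v i) > 0" if "i \<in> set ix" "ix \<in> tensor_indices r N" for i ix
    using that assms(2,3) unfolding tensor_indices_def bij_betw_def by blast
  \<comment> \<open>For \<open>r = 0\<close> the only index list is empty, hence diagonal; a
    non-diagonal list does have a first entry.\<close>
  have deg_head: "deg E w (v (ix ! 0)) > 0"
    if "\<not> diagonal_index ix" "ix \<in> tensor_indices r N" for ix
  proof -
    have "ix \<noteq> []" using that(1) by (auto simp: diagonal_index_def)
    then show ?thesis using deg_pos[OF _ that(2)] by (cases ix) auto
  qed
  have prod_nonzero: "(\<Prod>j \<in> set ix. deg E w (v j) powr p) \<noteq> 0"
    if "ix \<in> tensor_indices r N" for ix p
    using deg_pos[OF _ that] by fastforce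
  \<comment> \<open>Off the diagonal, each tensor is \<open>tensor_A\<close> up to sign and a factor
    made of positive degrees, so the supports agree.\<close>
  have equiv: "weakly_irreducible r N T \<longleftrightarrow> hypergraph_connected V E"
    if "\<And>ix. ix \<in> tensor_indices r N \<Longrightarrow> \<not> diagonal_index ix \<Longrightarrow>
      T ix \<noteq> 0 \<longleftrightarrow> tensor_A E w v ix \<noteq> 0" for T
    using that unfolding assms(4) tensor_A_nonzero_iff
    by (rule weakly_irreducible_iff_connected[OF assms(2)])
  show ?thesis
    by (intro conjI equiv)
      (simp_all add: tensor_K_def tensor_K_plus_def tensor_L_def tensor_L_plus_def
        tensor_calL_def tensor_calL_plus_def prod_nonzero deg_head[THEN less_imp_neq[THEN not_sym]]
        del: prod_zero_iff)
qed

end
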